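(* The sequence of lattices $L_1, L_2, L_3, \dots$, together with the face maps $d_i:L_n\to L_{n-1}$ ($n\ge 2$, $0\le i\le n-1$) and the degeneracy maps $s_j:L_n\to L_{n+1}$ ($n\ge 1$, $0\le j\le n-1$), is a simplicial lattice $L_\bullet$ whose set of $n$-simplices is $L_{n+1}$ for every $n\ge 0$.
   Context: For $n\in\mathbb{N}=\{1,2,3,\dots\}$ let $L_n=\{(x_1,\dots,x_n)\in[0,1]^n: x_1\le x_2\le\dots\le x_n\}$, a lattice under the componentwise order $(x_1,\dots,x_n)\le^n(y_1,\dots,y_n)\iff x_i\le y_i$ for all $i$. The face maps $d_i:L_n\to L_{n-1}$, $0\le i\le n-1$, are $$d_i(x_1,\dots,x_n)=\begin{cases}(x_2,\dots,x_n), & i=0,\\ (x_1,\dots,x_i,x_{i+2},\dots,x_n), & 0<i<n-1,\\ (x_1,\dots,x_{n-1}), & i=n-1.\end{cases}$$ The degeneracy maps $s_j:L_n\to L_{n+1}$, $0\le j\le n-1$, are $$s_j(x_1,\dots,x_n)=(x_1,\dots,x_j,x_{j+1},x_{j+1},x_{j+2},\dots,x_n).$$ A simplicial set $X_\bullet$ is a sequence of sets $\{X_n\}_{n\ge 0}$ with face maps $d_i:X_n\to X_{n-1}$ ($n\ge 1$, $0\le i\le n$) and degeneracy maps $s_j:X_n\to X_{n+1}$ ($0\le j\le n$) satisfying the simplicial identities: $d_id_j=d_{j-1}d_i$ if $i<j$; $s_is_j=s_js_{i-1}$ if $i>j$; $d_is_j=s_{j-1}d_i$ if $i<j$; $d_is_j=\mathrm{id}$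 if $i=j$ or $i=j+1$; $d_is_j=s_jd_{i-1}$ if $i>j+1$. The elements of $X_n$ are called $n$-simplices. If all $X_n$ are lattices and all $d_i$, $s_j$ are lattice homomorphisms, $X_\bullet$ is called a simplicial lattice. *)

theory Defs
  imports Complex_Main "HOL-Algebra.Lattice"
begin

(* d n i is the face map X n -> X (n - 1) and s n j is the degeneracy map X n -> X (n + 1).
   Functions are total in HOL, so every law is stated only on simplices and for the
   indices for which both sides are defined. *)
locale simplicial_set =
  fixes X :: "nat \<Rightarrow> 'a set"
    and d :: "nat \<Rightarrow> nat \<Rightarrow> 'a \<Rightarrow> 'a"
    and s :: "nat \<Rightarrow> nat \<Rightarrow> 'a \<Rightarrow> 'a"
  assumes face_closed:
      "\<lbrakk>1 \<le> n; i \<le> n; x \<in> X n\<rbrakk> \<Longrightarrow> d n i x \<in> X (n - 1)"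
    and degen_closed:
      "\<lbrakk>j \<le> n; x \<in> X n\<rbrakk> \<Longrightarrow> s n j x \<in> X (n + 1)"
    and face_face:
      "\<lbrakk>2 \<le> n; i < j; j \<le> n; x \<in> X n\<rbrakk>
        \<Longrightarrow> d (n - 1) i (d n j x) = d (n - 1) (j - 1) (d n i x)"
    and degen_degen:
      "\<lbrakk>j < i; i \<le> n + 1; x \<in> X n\<rbrakk>
        \<Longrightarrow> s (n + 1) i (s n j x) = s (n + 1) j (s n (i - 1) x)"
    and face_degen_less:
      "\<lbrakk>i < j; j \<le> n; x \<in> X n\<rbrakk>
        \<Longrightarrow> d (n + 1) i (s n j x) = s (n - 1) (j - 1) (d n i x)"
    and face_degen_id:
      "\<lbrakk>i = j \<or> i = j + 1; j \<le> n; x \<in> X n\<rbrakk>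
        \<Longrightarrow> d (n + 1) i (s n j x) = x"
    and face_degen_greater:
      "\<lbrakk>j + 1 < i; i \<le> n + 1; x \<in> X n\<rbrakk>
        \<Longrightarrow> d (n + 1) i (s n j x) = s (n - 1) j (d n (i - 1) x)"

definition lattice_hom :: "'a gorder \<Rightarrow> 'b gorder \<Rightarrow> ('a \<Rightarrow> 'b) \<Rightarrow> bool" where
  "lattice_hom A B f \<longleftrightarrow>
     f \<in> carrier A \<rightarrow> carrier B \<and> join_pres A B f \<and> meet_pres A B f"

locale simplicial_lattice =
  simplicial_set "\<lambda>n. carrier (X n)" d s
  for X :: "nat \<Rightarrow> 'a gorder"
    and d :: "nat \<Rightarrow> nat \<Rightarrow> 'a \<Rightarrow> 'a"
    and s :: "nat \<Rightarrow> nat \<Rightarrow> 'a \<Rightarrow> 'a" +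
  assumes lattices: "lattice (X n)"
    and face_hom: "\<lbrakk>1 \<le> n; i \<le> n\<rbrakk> \<Longrightarrow> lattice_hom (X n) (X (n - 1)) (d n i)"
    and degen_hom: "j \<le> n \<Longrightarrow> lattice_hom (X n) (X (n + 1)) (s n j)"

(* A tuple (x_1, ..., x_n) is the list xs of length n with x_k = xs ! (k - 1). *)
definition L :: "nat \<Rightarrow> real list set" where
  "L n = {xs. length xs = n \<and> set xs \<subseteq> {0..1} \<and> sorted xs}"

definition L_lattice :: "nat \<Rightarrow> real list gorder" where
  "L_lattice n = \<lparr>carrier = L n, eq = (=), le = (\<lambda>xs ys. \<forall>k<n. xs ! k \<le> ys ! k)\<rparr>"

(* The dimension n has to be a parameter, since the last case depends on it. *)
definition face :: "nat \<Rightarrow> nat \<Rightarrow> real list \<Rightarrow> real list" where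
  "face n i xs =
     (if i = 0 then tl xs
      else if i < n - 1 then take i xs @ drop (i + 1) xs
      else butlast xs)"

(* (x_1, ..., x_{j+1}) followed by (x_{j+1}, ..., x_n) *)
definition degen :: "nat \<Rightarrow> real list \<Rightarrow> real list" where
  "degen j xs = take (j + 1) xs @ drop j xs"

end

theory Submission
  imports Defs
begin

text \<open>
  A point of \<^term>\<open>L n\<close> is a monotone map from the finite ordinal \<open>{0 < \<dots> < n - 1}\<close> to \<open>[0,1]\<close>,
  and \<open>L\<^sub>\<bullet>\<close> is the functor represented by the chain \<open>[0,1]\<close>, restricted to the simplex category:
  a monotone \<open>\<phi>\<close> between finite ordinals acts by precomposition. The face \<open>d\<^sub>i\<close> is precomposition
  with the injection that skips \<open>i\<close> (lemma \<open>face_eq_reindex\<close>), and the degeneracy \<open>s\<^sub>j\<close> is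
  precomposition with the surjection that hits \<open>j\<close> twice (lemma \<open>degen_eq_reindex\<close>).

  Two facts about precomposition give everything. It is functorial (\<open>reindex_reindex\<close>), so each
  simplicial identity reduces to the dual identity between maps of natural numbers, which is a case
  distinction. And it commutes with every operation that is computed entry by entry
  (\<open>reindex_pointwise\<close>); since maxima and minima of monotone tuples are monotone, the joins and
  meets of \<^term>\<open>L n\<close> are computed entry by entry (\<open>join_L_lattice\<close>, \<open>meet_L_lattice\<close>), and
  precomposition preserves them.
\<close>

lemma L_iff_nth:
  "xs \<in> L n \<longleftrightarrow>
     length xs = n \<and> (\<forall>k<n. 0 \<le> xs ! k \<and> xs ! k \<le> 1)
     \<and> (\<forall>k l. k \<le> l \<longrightarrow> l < n \<longrightarrow> xs ! k \<le> xs ! l)"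
  by (auto simp: L_def sorted_iff_nth_mono in_set_conv_nth subset_iff)

lemma L_length: "xs \<in> L n \<Longrightarrow> length xs = n"
  by (simp add: L_def)

section \<open>The lattice of monotone tuples\<close>

definition pointwise :: "(real \<Rightarrow> real \<Rightarrow> real) \<Rightarrow> nat \<Rightarrow> real list \<Rightarrow> real list \<Rightarrow> real list" where
  "pointwise f n xs ys = map (\<lambda>k. f (xs ! k) (ys ! k)) [0..<n]"

lemma pointwise_nth [simp]: "k < n \<Longrightarrow> pointwise f n xs ys ! k = f (xs ! k) (ys ! k)"
  by (simp add: pointwise_def)

lemma pointwise_max_in_L: "xs \<in> L n \<Longrightarrow> ys \<in> L n \<Longrightarrow> pointwise max n xs ys \<in> L n"
  unfolding L_iff_nth by (auto simp: pointwise_def intro: max.coboundedI1 max.coboundedI2)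

lemma pointwise_min_in_L: "xs \<in> L n \<Longrightarrow> ys \<in> L n \<Longrightarrow> pointwise min n xs ys \<in> L n"
  unfolding L_iff_nth by (auto simp: pointwise_def intro: min.coboundedI1 min.coboundedI2)

lemma carrier_L_lattice [simp]: "carrier (L_lattice n) = L n"
  by (simp add: L_lattice_def)

lemma le_L_lattice: "le (L_lattice n) xs ys \<longleftrightarrow> (\<forall>k<n. xs ! k \<le> ys ! k)"
  by (simp add: L_lattice_def)

lemma L_lattice_partial_order: "partial_order (L_lattice n)"
proof
  fix x y assume "le (L_lattice n) x y" "le (L_lattice n) y x"
    "x \<in> carrier (L_lattice n)" "y \<in> carrier (L_lattice n)"
  then have "x = y"
    by (auto simp: le_L_lattice L_length intro!: nth_equalityI antisym)
  then show "x .=\<^bsub>L_lattice n\<^esub> y" by (simp add: L_lattice_def)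
qed (auto simp: L_lattice_def intro: order_trans)

lemma pointwise_max_is_lub:
  assumes "xs \<in> L n" "ys \<in> L n"
  shows "least (L_lattice n) (pointwise max n xs ys) (Upper (L_lattice n) {xs, ys})"
  using assms pointwise_max_in_L[OF assms]
  by (intro least_UpperI) (auto simp: le_L_lattice Upper_def)

lemma pointwise_min_is_glb:
  assumes "xs \<in> L n" "ys \<in> L n"
  shows "greatest (L_lattice n) (pointwise min n xs ys) (Lower (L_lattice n) {xs, ys})"
  using assms pointwise_min_in_L[OF assms]
  by (intro greatest_LowerI) (auto simp: le_L_lattice Lower_def)

lemma lattice_L_lattice: "lattice (L_lattice n)"
proof -
  interpret partial_order "L_lattice n" by (rule L_lattice_partial_order)
  show ?thesis
    by unfold_locales (use pointwise_max_is_lub pointwise_min_is_glb in \<open>simp, blast\<close>)+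
qed

lemma join_L_lattice:
  assumes "xs \<in> L n" "ys \<in> L n"
  shows "xs \<squnion>\<^bsub>L_lattice n\<^esub> ys = pointwise max n xs ys"
  unfolding join_def sup_def
  using pointwise_max_is_lub[OF assms]
    partial_order.least_unique[OF L_lattice_partial_order] by blast

lemma meet_L_lattice:
  assumes "xs \<in> L n" "ys \<in> L n"
  shows "xs \<sqinter>\<^bsub>L_lattice n\<^esub> ys = pointwise min n xs ys"
  unfolding meet_def inf_def
  using pointwise_min_is_glb[OF assms]
    partial_order.greatest_unique[OF L_lattice_partial_order] by blast

section \<open>Precomposition with monotone maps\<close>

definition reindex :: "nat \<Rightarrow> (nat \<Rightarrow> nat) \<Rightarrow> real list \<Rightarrow> real list" where
  "reindex m \<phi> xs = map (\<lambda>k. xs ! \<phi> k) [0..<m]"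

lemma length_reindex [simp]: "length (reindex m \<phi> xs) = m"
  by (simp add: reindex_def)

lemma reindex_nth [simp]: "k < m \<Longrightarrow> reindex m \<phi> xs ! k = xs ! \<phi> k"
  by (simp add: reindex_def)

lemma reindex_reindex:
  assumes "\<And>k. k < p \<Longrightarrow> \<phi> k < m"
  shows "reindex p \<phi> (reindex m \<psi> xs) = reindex p (\<psi> \<circ> \<phi>) xs"
  using assms by (intro nth_equalityI) auto

lemma reindex_pointwise:
  assumes "\<And>k. k < m \<Longrightarrow> \<phi> k < n"
  shows "reindex m \<phi> (pointwise f n xs ys) = pointwise f m (reindex m \<phi> xs) (reindex m \<phi> ys)"
  using assms by (intro nth_equalityI) (auto simp: pointwise_def)

lemma reindex_in_L:
  assumes "mono \<phi>" and "\<And>k. k < m \<Longrightarrow> \<phi> k < n" and "xs \<in> L n"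
  shows "reindex m \<phi> xs \<in> L m"
  using assms by (auto simp: L_iff_nth dest: monoD)

lemma lattice_hom_reindex:
  assumes "mono \<phi>" and "\<And>k. k < m \<Longrightarrow> \<phi> k < n"
  shows "lattice_hom (L_lattice n) (L_lattice m) (reindex m \<phi>)"
  using reindex_in_L[OF assms] reindex_pointwise[OF assms(2)]
  by (simp add: lattice_hom_def join_pres_def meet_pres_def lattice_L_lattice
      join_L_lattice meet_L_lattice pointwise_max_in_L pointwise_min_in_L)

text \<open>Lattice homomorphisms are only constrained on the carrier, so it suffices to recognise a
  precomposition there.\<close>

lemma lattice_hom_cong:
  assumes "lattice_hom A B f" and "\<And>x. x \<in> carrier A \<Longrightarrow> g x = f x"
  shows "lattice_hom A B g"
proof -
  interpret A: lattice A using assms(1) by (simp add: lattice_hom_def join_pres_def)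
  show ?thesis
    using assms by (auto simp: lattice_hom_def join_pres_def meet_pres_def)
qed

section \<open>Faces and degeneracies as precompositions\<close>

text \<open>The coface map, the monotone injection whose only omitted value is \<open>i\<close>.\<close>

definition skip :: "nat \<Rightarrow> nat \<Rightarrow> nat" where
  "skip i k = (if k < i then k else Suc k)"

text \<open>The codegeneracy map, the monotone surjection that identifies \<open>j\<close> and \<open>j + 1\<close>.\<close>

definition merge :: "nat \<Rightarrow> nat \<Rightarrow> nat" where
  "merge j k = (if k \<le> j then k else k - 1)"

lemma mono_skip: "mono (skip i)"
  by (auto simp: mono_def skip_def)

lemma mono_merge: "mono (merge j)"
  by (auto simp: mono_def merge_def)

lemma skip_less: "k < n \<Longrightarrow> skip i k < Suc n"
  by (simp add: skip_def)

lemma merge_less: "j < n \<Longrightarrow> k < Suc n \<Longrightarrow> merge j k < n"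
  by (auto simp: merge_def)

text \<open>The three cases in the definition of a face all delete the entry with index \<open>i\<close>; the first and
  the last are those where nothing stands before or after it.\<close>

lemma face_eq_reindex:
  assumes "length xs = Suc n" and "i \<le> n"
  shows "face (Suc n) i xs = reindex n (skip i) xs"
  using assms by (intro nth_equalityI)
    (auto simp: face_def skip_def nth_tl nth_butlast nth_append min_def)

lemma degen_eq_reindex:
  assumes "length xs = n" and "j < n"
  shows "degen j xs = reindex (Suc n) (merge j) xs"
  using assms by (intro nth_equalityI)
    (auto simp: degen_def merge_def nth_append min_def
      intro!: arg_cong[where f = "nth xs"])

text \<open>The cosimplicial identities. They hold on all of \<^typ>\<open>nat\<close>, because the formulas for \<open>skip\<close> and
  \<open>merge\<close> do not mention the size of the ordinal. Precomposition is contravariant, so each composite appears in the order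
  opposite to the simplicial identity that it yields.\<close>

lemma skip_skip: "i < j \<Longrightarrow> skip j \<circ> skip i = skip i \<circ> skip (j - 1)"
  by (auto simp: skip_def fun_eq_iff)

lemma merge_merge: "j < i \<Longrightarrow> merge j \<circ> merge i = merge (i - 1) \<circ> merge j"
  by (auto simp: merge_def fun_eq_iff)

lemma merge_skip_less: "i < j \<Longrightarrow> merge j \<circ> skip i = skip i \<circ> merge (j - 1)"
  by (auto simp: skip_def merge_def fun_eq_iff)

lemma merge_skip_id: "i = j \<or> i = j + 1 \<Longrightarrow> merge j \<circ> skip i = id"
  by (auto simp: skip_def merge_def fun_eq_iff)

lemma merge_skip_greater: "j + 1 < i \<Longrightarrow> merge j \<circ> skip i = skip (i - 1) \<circ> merge j"
  by (auto simp: skip_def merge_def fun_eq_iff)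

lemma reindex_id: "length xs = n \<Longrightarrow> reindex n id xs = xs"
  by (intro nth_equalityI) auto

text \<open>In each identity both sides become precomposition with a single map, and the two maps agree by
  the corresponding cosimplicial identity.\<close>

lemma simplicial_set_L:
  "simplicial_set (\<lambda>n. L (n + 1)) (\<lambda>n i. face (n + 1) i) (\<lambda>n j. degen j)"
proof
  fix n i x assume "1 \<le> n" "i \<le> n" "x \<in> L (n + 1)"
  then show "face (n + 1) i x \<in> L (n - 1 + 1)"
    by (simp add: face_eq_reindex L_length reindex_in_L[where n = "Suc n"] mono_skip skip_less)
next
  fix n j x assume "j \<le> n" "x \<in> L (n + 1)"
  then show "degen j x \<in> L (n + 1 + 1)"
    by (simp add: degen_eq_reindex[where n = "Suc n"] L_length reindex_in_L[where n = "Suc n"]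
        mono_merge merge_less)
next
  fix n i j x assume a: "2 \<le> n" "i < j" "j \<le> n" "x \<in> L (n + 1)"
  then obtain m where "n = Suc m" by (cases n) auto
  with a show "face (n - 1 + 1) i (face (n + 1) j x)
      = face (n - 1 + 1) (j - 1) (face (n + 1) i x)"
    by (simp add: face_eq_reindex L_length reindex_reindex skip_less skip_skip)
next
  fix n i j x assume "j < i" "i \<le> n + 1" "x \<in> L (n + 1)"
  then show "degen i (degen j x) = degen j (degen (i - 1) x)"
    by (simp add: degen_eq_reindex[where n = "Suc n"] degen_eq_reindex[where n = "Suc (Suc n)"]
        L_length reindex_reindex merge_less merge_merge)
next
  fix n i j x assume a: "i < j" "j \<le> n" "x \<in> L (n + 1)"
  then obtain m where "n = Suc m" by (cases n) auto
  with a show "face (n + 1 + 1) i (degen j x) = degen (j - 1) (face (n + 1) i x)"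
    by (simp add: face_eq_reindex degen_eq_reindex[where n = "Suc m"]
        degen_eq_reindex[where n = "Suc (Suc m)"] L_length reindex_reindex skip_less merge_less
        merge_skip_less)
next
  fix n i j x assume "i = j \<or> i = j + 1" "j \<le> n" "x \<in> L (n + 1)"
  moreover from this have "i \<le> Suc n" by auto
  ultimately show "face (n + 1 + 1) i (degen j x) = x"
    by (simp add: face_eq_reindex degen_eq_reindex[where n = "Suc n"] L_length reindex_reindex
        skip_less merge_skip_id[simplified] reindex_id)
next
  fix n i j x assume a: "j + 1 < i" "i \<le> n + 1" "x \<in> L (n + 1)"
  then obtain m where "n = Suc m" by (cases n) auto
  with a show "face (n + 1 + 1) i (degen j x) = degen j (face (n + 1) (i - 1) x)"
    by (simp add: face_eq_reindex degen_eq_reindex[where n = "Suc m"]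
        degen_eq_reindex[where n = "Suc (Suc m)"] L_length reindex_reindex skip_less merge_less
        merge_skip_greater)
qed

lemma lattice_hom_face:
  assumes "i \<le> n"
  shows "lattice_hom (L_lattice (Suc n)) (L_lattice n) (face (Suc n) i)"
  by (rule lattice_hom_cong[OF lattice_hom_reindex[OF mono_skip skip_less]])
    (use assms in \<open>auto simp: face_eq_reindex L_length\<close>)

lemma lattice_hom_degen:
  assumes "j < n"
  shows "lattice_hom (L_lattice n) (L_lattice (Suc n)) (degen j)"
  by (rule lattice_hom_cong[OF lattice_hom_reindex[OF mono_merge merge_less]])
    (use assms in \<open>auto simp: degen_eq_reindex L_length\<close>)

theorem theorem9:
  shows "simplicial_lattice (\<lambda>n. L_lattice (n + 1)) (\<lambda>n i. face (n + 1) i) (\<lambda>n j. degen j)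
    \<and> (\<forall>n. carrier (L_lattice (n + 1)) = L (n + 1))"
proof
  show "simplicial_lattice (\<lambda>n. L_lattice (n + 1)) (\<lambda>n i. face (n + 1) i) (\<lambda>n j. degen j)"
  proof (intro simplicial_lattice.intro simplicial_lattice_axioms.intro)
    show "simplicial_set (\<lambda>n. carrier (L_lattice (n + 1))) (\<lambda>n i. face (n + 1) i)
        (\<lambda>n j. degen j)"
      using simplicial_set_L by simp
  qed (simp_all add: lattice_L_lattice lattice_hom_face lattice_hom_degen)
qed simp

end
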